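(* Let $\mathcal{I}$ be a small category, let $\iota\colon\mathcal{O}\hookrightarrow\mathcal{I}$ be the inclusion of a full subcategory, let $\mathcal{C}$ be a category and let $\mathcal{L}\colon\mathcal{O}\to\mathcal{C}$ be a functor. If the left Kan extension $\mathrm{Lan}_{\iota}\mathcal{L}$ of $\mathcal{L}$ along $\iota$ exists, then it is an initial object of $\mathsf{Auto}(\mathcal{L})$; that is, an initial object $\mathcal{A}^{\mathit{init}}(\mathcal{L})$ of $\mathsf{Auto}(\mathcal{L})$ exists and is isomorphic (as a functor $\mathcal{I}\to\mathcal{C}$) to $\mathrm{Lan}_{\iota}\mathcal{L}$. Dually, if the right Kan extension $\mathrm{Ran}_{\iota}\mathcal{L}$ of $\mathcal{L}$ along $\iota$ exists, then a final (terminal) object $\mathcal{A}^{\mathit{final}}(\mathcal{L})$ of $\mathsf{Auto}(\mathcal{L})$ exists and is isomorphic to $\mathrm{Ran}_{\iota}\mathcal{L}$.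
   Context: A functor $\mathcal{A}\colon\mathcal{I}\to\mathcal{C}$ (a $\mathcal{C}$-automaton) accepts the functor $\mathcal{L}\colon\mathcal{O}\to\mathcal{C}$ (a $\mathcal{C}$-language) when $\mathcal{A}\circ\iota=\mathcal{L}$. The category $\mathsf{Auto}(\mathcal{L})$ is the subcategory of the functor category $[\mathcal{I},\mathcal{C}]$ whose objects are the functors $\mathcal{A}$ with $\mathcal{A}\circ\iota=\mathcal{L}$ (strict equality) and whose arrows $\mathcal{A}\to\mathcal{B}$ are the natural transformations $\alpha\colon\mathcal{A}\to\mathcal{B}$ with $\alpha\circ\iota=\mathrm{id}_{\mathcal{L}}$. Kan extensions are understood up to isomorphism: since $\iota$ is full and faithful, the restriction of a Kan extension along $\iota$ is canonically isomorphic to $\mathcal{L}$, and one replaces the Kan extension by an isomorphic functor restricting strictly to $\mathcal{L}$ (with unit, respectively counit, the identity) when regarding it as an object of $\mathsf{Auto}(\mathcal{L})$.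
   Formalization: The left (right) Kan extension is required to be pointwise or to have an invertible unit (counit): for a non-pointwise Kan extension along a full inclusion the restriction need not be isomorphic to L, and Auto(L) can then be empty. *)

theory Defs
  imports Main "HOL-Library.FuncSet"
begin

text \<open>
  Categories are given by carrier sets of objects and arrows inside two types. Every such
  category is small, relative to those types, and nothing ties the types of two different
  categories together.  Composition is written in the usual order, so \<open>g \<cdot>\<^bsub>C\<^esub> f\<close> is
  \<open>f\<close> followed by \<open>g\<close>.
\<close>

record ('o, 'a) cat =
  Obj :: "'o set"
  Arr :: "'a set"
  Dom :: "'a \<Rightarrow> 'o"
  Cod :: "'a \<Rightarrow> 'o"
  Ident :: "'o \<Rightarrow> 'a"
  Comp :: "'a \<Rightarrow> 'a \<Rightarrow> 'a" (infixr \<open>\<cdot>\<index>\<close> 70)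

definition Hom :: "('o, 'a) cat \<Rightarrow> 'o \<Rightarrow> 'o \<Rightarrow> 'a set" where
  "Hom C x y = {f \<in> Arr C. Dom C f = x \<and> Cod C f = y}"

locale category =
  fixes C :: "('o, 'a) cat" (structure)
  assumes Dom_in: "f \<in> Arr C \<Longrightarrow> Dom C f \<in> Obj C"
    and Cod_in: "f \<in> Arr C \<Longrightarrow> Cod C f \<in> Obj C"
    and Ident_in: "x \<in> Obj C \<Longrightarrow> Ident C x \<in> Hom C x x"
    and Comp_in: "f \<in> Hom C x y \<Longrightarrow> g \<in> Hom C y z \<Longrightarrow> g \<cdot> f \<in> Hom C x z"
    and Ident_left: "f \<in> Hom C x y \<Longrightarrow> Ident C y \<cdot> f = f"
    and Ident_right: "f \<in> Hom C x y \<Longrightarrow> f \<cdot> Ident C x = f"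
    and Comp_assoc: "f \<in> Hom C w x \<Longrightarrow> g \<in> Hom C x y \<Longrightarrow> h \<in> Hom C y z \<Longrightarrow>
                       (h \<cdot> g) \<cdot> f = h \<cdot> (g \<cdot> f)"

definition is_iso :: "('o, 'a) cat \<Rightarrow> 'a \<Rightarrow> bool" where
  "is_iso C f \<longleftrightarrow> f \<in> Arr C \<and> (\<exists>g \<in> Hom C (Cod C f) (Dom C f).
     g \<cdot>\<^bsub>C\<^esub> f = Ident C (Dom C f) \<and> f \<cdot>\<^bsub>C\<^esub> g = Ident C (Cod C f))"

definition isomorphic :: "('o, 'a) cat \<Rightarrow> 'o \<Rightarrow> 'o \<Rightarrow> bool" where
  "isomorphic C x y \<longleftrightarrow> (\<exists>f \<in> Hom C x y. is_iso C f)"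

definition initial_object :: "('o, 'a) cat \<Rightarrow> 'o \<Rightarrow> bool" where
  "initial_object C x \<longleftrightarrow> x \<in> Obj C \<and> (\<forall>y \<in> Obj C. \<exists>!f. f \<in> Hom C x y)"

definition final_object :: "('o, 'a) cat \<Rightarrow> 'o \<Rightarrow> bool" where
  "final_object C x \<longleftrightarrow> x \<in> Obj C \<and> (\<forall>y \<in> Obj C. \<exists>!f. f \<in> Hom C y x)"

definition full_subcategory :: "('o, 'a) cat \<Rightarrow> 'o set \<Rightarrow> ('o, 'a) cat" where
  "full_subcategory C S = C\<lparr>Obj := S, Arr := {f \<in> Arr C. Dom C f \<in> S \<and> Cod C f \<in> S}\<rparr>"


text \<open>
  Functors and natural transformations are required to be extensional on the source category,
  i.e. to take the value \<^const>\<open>undefined\<close> outside its carriers, so that HOL equality is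
  equality of functors and of natural transformations.
\<close>

record ('o, 'a, 'p, 'b) func =
  FObj :: "'o \<Rightarrow> 'p"
  FArr :: "'a \<Rightarrow> 'b"

definition is_functor ::
  "('o, 'a) cat \<Rightarrow> ('p, 'b) cat \<Rightarrow> ('o, 'a, 'p, 'b) func \<Rightarrow> bool" where
  "is_functor J C F \<longleftrightarrow>
     FObj F \<in> extensional (Obj J) \<and> FArr F \<in> extensional (Arr J) \<and>
     (\<forall>x \<in> Obj J. FObj F x \<in> Obj C) \<and>
     (\<forall>f \<in> Arr J. FArr F f \<in> Hom C (FObj F (Dom J f)) (FObj F (Cod J f))) \<and>
     (\<forall>x \<in> Obj J. FArr F (Ident J x) = Ident C (FObj F x)) \<and>
     (\<forall>f \<in> Arr J. \<forall>g \<in> Arr J. Cod J f = Dom J g \<longrightarrow>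
        FArr F (g \<cdot>\<^bsub>J\<^esub> f) = FArr F g \<cdot>\<^bsub>C\<^esub> FArr F f)"

text \<open>In \<open>fcomp J G F\<close> and \<open>whisker J \<tau> F\<close> the category \<open>J\<close> is the source of \<open>F\<close>.\<close>

definition fcomp ::
  "('o, 'a) cat \<Rightarrow> ('p, 'b, 'q, 'c) func \<Rightarrow> ('o, 'a, 'p, 'b) func \<Rightarrow> ('o, 'a, 'q, 'c) func" where
  "fcomp J G F = \<lparr>FObj = compose (Obj J) (FObj G) (FObj F),
                  FArr = compose (Arr J) (FArr G) (FArr F)\<rparr>"

definition inclusion :: "('o, 'a) cat \<Rightarrow> ('o, 'a, 'o, 'a) func" where
  "inclusion J = \<lparr>FObj = (\<lambda>x \<in> Obj J. x), FArr = (\<lambda>f \<in> Arr J. f)\<rparr>"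

record ('o, 'a, 'p, 'b) nattrans =
  NDom :: "('o, 'a, 'p, 'b) func"
  NCod :: "('o, 'a, 'p, 'b) func"
  NComp :: "'o \<Rightarrow> 'b"

definition is_nattrans ::
  "('o, 'a) cat \<Rightarrow> ('p, 'b) cat \<Rightarrow> ('o, 'a, 'p, 'b) nattrans \<Rightarrow> bool" where
  "is_nattrans J C \<tau> \<longleftrightarrow>
     is_functor J C (NDom \<tau>) \<and> is_functor J C (NCod \<tau>) \<and>
     NComp \<tau> \<in> extensional (Obj J) \<and>
     (\<forall>x \<in> Obj J. NComp \<tau> x \<in> Hom C (FObj (NDom \<tau>) x) (FObj (NCod \<tau>) x)) \<and>
     (\<forall>f \<in> Arr J. NComp \<tau> (Cod J f) \<cdot>\<^bsub>C\<^esub> FArr (NDom \<tau>) f =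
                   FArr (NCod \<tau>) f \<cdot>\<^bsub>C\<^esub> NComp \<tau> (Dom J f))"

definition functor_category ::
  "('o, 'a) cat \<Rightarrow> ('p, 'b) cat \<Rightarrow>
     (('o, 'a, 'p, 'b) func, ('o, 'a, 'p, 'b) nattrans) cat" where
  "functor_category J C =
     \<lparr>Obj = {F. is_functor J C F},
      Arr = {\<tau>. is_nattrans J C \<tau>},
      Dom = NDom,
      Cod = NCod,
      Ident = (\<lambda>F. \<lparr>NDom = F, NCod = F, NComp = (\<lambda>x \<in> Obj J. Ident C (FObj F x))\<rparr>),
      Comp = (\<lambda>\<sigma> \<tau>. \<lparr>NDom = NDom \<tau>, NCod = NCod \<sigma>,
                      NComp = (\<lambda>x \<in> Obj J. NComp \<sigma> x \<cdot>\<^bsub>C\<^esub> NComp \<tau> x)\<rparr>)\<rparr>"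

definition whisker ::
  "('o, 'a) cat \<Rightarrow> ('p, 'b, 'q, 'c) nattrans \<Rightarrow> ('o, 'a, 'p, 'b) func
     \<Rightarrow> ('o, 'a, 'q, 'c) nattrans" where
  "whisker J \<tau> F = \<lparr>NDom = fcomp J (NDom \<tau>) F, NCod = fcomp J (NCod \<tau>) F,
                    NComp = compose (Obj J) (NComp \<tau>) (FObj F)\<rparr>"


text \<open>
  \<open>left_Kan J I C H L K \<eta>\<close>: the functor \<open>K\<close> from \<open>I\<close> to \<open>C\<close> with unit
  \<open>\<eta>\<close> from \<open>L\<close> to \<open>K \<circ> H\<close> is a left Kan extension of \<open>L\<close> (from \<open>J\<close> to \<open>C\<close>) along
  \<open>H\<close> (from \<open>J\<close> to \<open>I\<close>).
\<close>

definition left_Kan where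
  "left_Kan J I C H L K \<eta> \<longleftrightarrow>
     K \<in> Obj (functor_category I C) \<and>
     \<eta> \<in> Hom (functor_category J C) L (fcomp J K H) \<and>
     (\<forall>G \<in> Obj (functor_category I C).
        \<forall>\<alpha> \<in> Hom (functor_category J C) L (fcomp J G H).
          \<exists>!\<sigma>. \<sigma> \<in> Hom (functor_category I C) K G \<and>
               whisker J \<sigma> H \<cdot>\<^bsub>functor_category J C\<^esub> \<eta> = \<alpha>)"

definition right_Kan where
  "right_Kan J I C H L K \<epsilon> \<longleftrightarrow>
     K \<in> Obj (functor_category I C) \<and>
     \<epsilon> \<in> Hom (functor_category J C) (fcomp J K H) L \<and>
     (\<forall>G \<in> Obj (functor_category I C).
        \<forall>\<alpha> \<in> Hom (functor_category J C) (fcomp J G H) L.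
          \<exists>!\<sigma>. \<sigma> \<in> Hom (functor_category I C) G K \<and>
               \<epsilon> \<cdot>\<^bsub>functor_category J C\<^esub> whisker J \<sigma> H = \<alpha>)"

text \<open>
  A Kan extension is pointwise when, at every object \<open>i\<close> of \<open>I\<close>, the canonical cocone with
  components \<open>K f \<circ> \<eta> x\<close>, indexed by the objects \<open>(x, f : H x \<rightarrow> i)\<close> of the comma category
  \<open>H \<down> i\<close>, is a colimit of \<open>H \<down> i \<rightarrow> J \<rightarrow> C\<close>.  Dually, the cone with components
  \<open>\<epsilon> x \<circ> K f\<close>, indexed by the objects \<open>(x, f : i \<rightarrow> H x)\<close> of \<open>i \<down> H\<close>, has to be a limit.
\<close>

definition comma_cocone where
  "comma_cocone J I C H L i y c \<longleftrightarrow>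
     (\<forall>x \<in> Obj J. \<forall>f \<in> Hom I (FObj H x) i. c x f \<in> Hom C (FObj L x) y) \<and>
     (\<forall>u \<in> Arr J. \<forall>f \<in> Hom I (FObj H (Cod J u)) i.
        c (Cod J u) f \<cdot>\<^bsub>C\<^esub> FArr L u = c (Dom J u) (f \<cdot>\<^bsub>I\<^esub> FArr H u))"

definition pointwise_left where
  "pointwise_left J I C H L K \<eta> \<longleftrightarrow>
     (\<forall>i \<in> Obj I. \<forall>y \<in> Obj C. \<forall>c. comma_cocone J I C H L i y c \<longrightarrow>
        (\<exists>!h. h \<in> Hom C (FObj K i) y \<and>
              (\<forall>x \<in> Obj J. \<forall>f \<in> Hom I (FObj H x) i.
                 h \<cdot>\<^bsub>C\<^esub> (FArr K f \<cdot>\<^bsub>C\<^esub> NComp \<eta> x) = c x f)))"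

definition comma_cone where
  "comma_cone J I C H L i y c \<longleftrightarrow>
     (\<forall>x \<in> Obj J. \<forall>f \<in> Hom I i (FObj H x). c x f \<in> Hom C y (FObj L x)) \<and>
     (\<forall>u \<in> Arr J. \<forall>f \<in> Hom I i (FObj H (Dom J u)).
        FArr L u \<cdot>\<^bsub>C\<^esub> c (Dom J u) f = c (Cod J u) (FArr H u \<cdot>\<^bsub>I\<^esub> f))"

definition pointwise_right where
  "pointwise_right J I C H L K \<epsilon> \<longleftrightarrow>
     (\<forall>i \<in> Obj I. \<forall>y \<in> Obj C. \<forall>c. comma_cone J I C H L i y c \<longrightarrow>
        (\<exists>!h. h \<in> Hom C y (FObj K i) \<and>
              (\<forall>x \<in> Obj J. \<forall>f \<in> Hom I i (FObj H x).
                 (NComp \<epsilon> x \<cdot>\<^bsub>C\<^esub> FArr K f) \<cdot>\<^bsub>C\<^esub> h = c x f)))"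


definition accepts where
  "accepts J A L \<longleftrightarrow> fcomp J A (inclusion J) = L"

definition Auto ::
  "('o, 'a) cat \<Rightarrow> ('o, 'a) cat \<Rightarrow> ('p, 'b) cat \<Rightarrow> ('o, 'a, 'p, 'b) func \<Rightarrow>
     (('o, 'a, 'p, 'b) func, ('o, 'a, 'p, 'b) nattrans) cat" where
  "Auto J I C L = (functor_category I C)
     \<lparr>Obj := {A \<in> Obj (functor_category I C). accepts J A L},
      Arr := {\<alpha> \<in> Arr (functor_category I C).
                accepts J (NDom \<alpha>) L \<and> accepts J (NCod \<alpha>) L \<and>
                whisker J \<alpha> (inclusion J) = Ident (functor_category J C) L}\<rparr>"

text \<open>
  For a full subcategory \<open>J\<close> of \<open>I\<close>, the unit of a pointwise left Kan extension along the
  inclusion is an isomorphism. Without pointwiseness this can fail, even though the inclusion is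
  full and faithful, and then \<^const>\<open>Auto\<close> may have no object at all: let \<open>I\<close> be the span
  \<open>o \<leftarrow> p \<rightarrow> o'\<close> with \<open>J\<close> discrete on \<open>{o, o'}\<close>, let \<open>C\<close> be the poset generated by
  \<open>a \<le> a'\<close>, \<open>b \<le> b'\<close>, \<open>z \<le> a'\<close>, \<open>z \<le> b'\<close>, and let \<open>L\<close> send \<open>o, o'\<close> to \<open>a, b\<close>; the
  left Kan extension is the span \<open>a' \<leftarrow> z \<rightarrow> b'\<close>, while no functor extends \<open>L\<close> strictly.
  So \<open>Lan\<close> and \<open>Ran\<close> denote Kan extensions along the inclusion that are pointwise or whose
  unit (counit) is an isomorphism, which is the canonical isomorphism between \<open>L\<close> and the
  restriction of the extension.
\<close>

definition is_Lan where
  "is_Lan J I C L K \<eta> \<longleftrightarrow>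
     left_Kan J I C (inclusion J) L K \<eta> \<and>
     (pointwise_left J I C (inclusion J) L K \<eta> \<or> is_iso (functor_category J C) \<eta>)"

definition is_Ran where
  "is_Ran J I C L K \<epsilon> \<longleftrightarrow>
     right_Kan J I C (inclusion J) L K \<epsilon> \<and>
     (pointwise_right J I C (inclusion J) L K \<epsilon> \<or> is_iso (functor_category J C) \<epsilon>)"

end

theory Submission
  imports Defs
begin

text \<open>
  If the unit \<open>\<eta>\<close> of a left Kan extension \<open>K\<close> is invertible, then transporting the structure of
  \<open>K\<close> along the inverses of the components of \<open>\<eta>\<close> on \<open>J\<close>, and along identities elsewhere, gives
  an isomorphic functor \<open>A\<close> which restricts strictly to \<open>L\<close> and is a left Kan extension with
  identity unit.  Its universal property for the transformations \<open>id : L \<rightarrow> B \<circ> \<iota>\<close>, where \<open>B\<close>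
  accepts \<open>L\<close>, is initiality.  If the extension is pointwise, the unit is invertible because the
  comma category \<open>\<iota> \<down> j\<close> has the final object \<open>(j, id)\<close> whenever \<open>j\<close> lies in \<open>J\<close>.
  The statement for right Kan extensions follows by passing to opposite categories.
\<close>

section \<open>Functor categories\<close>

lemma Hom_iff: "f \<in> Hom C x y \<longleftrightarrow> f \<in> Arr C \<and> Dom C f = x \<and> Cod C f = y"
  by (auto simp: Hom_def)

lemma Arr_Hom: "f \<in> Arr C \<Longrightarrow> f \<in> Hom C (Dom C f) (Cod C f)"
  by (simp add: Hom_iff)

lemma (in category) Hom_objects: "f \<in> Hom C x y \<Longrightarrow> x \<in> Obj C \<and> y \<in> Obj C"
  using Dom_in Cod_in by (auto simp: Hom_iff)

lemma is_functorD:
  assumes "is_functor J C F"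
  shows "x \<in> Obj J \<Longrightarrow> FObj F x \<in> Obj C"
    and "f \<in> Hom J x y \<Longrightarrow> FArr F f \<in> Hom C (FObj F x) (FObj F y)"
    and "x \<in> Obj J \<Longrightarrow> FArr F (Ident J x) = Ident C (FObj F x)"
    and "f \<in> Hom J x y \<Longrightarrow> g \<in> Hom J y z \<Longrightarrow>
      FArr F (g \<cdot>\<^bsub>J\<^esub> f) = FArr F g \<cdot>\<^bsub>C\<^esub> FArr F f"
  using assms by (auto simp: is_functor_def Hom_iff)

lemma is_nattransD:
  assumes "is_nattrans J C \<tau>"
  shows "x \<in> Obj J \<Longrightarrow> NComp \<tau> x \<in> Hom C (FObj (NDom \<tau>) x) (FObj (NCod \<tau>) x)"
    and "f \<in> Hom J x y \<Longrightarrow> NComp \<tau> y \<cdot>\<^bsub>C\<^esub> FArr (NDom \<tau>) f = FArr (NCod \<tau>) f \<cdot>\<^bsub>C\<^esub> NComp \<tau> x"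
  using assms by (auto simp: is_nattrans_def Hom_iff)

lemma functor_category_simps [simp]:
  "F \<in> Obj (functor_category J C) \<longleftrightarrow> is_functor J C F"
  "\<tau> \<in> Arr (functor_category J C) \<longleftrightarrow> is_nattrans J C \<tau>"
  "Dom (functor_category J C) = NDom"
  "Cod (functor_category J C) = NCod"
  "NDom (Ident (functor_category J C) F) = F"
  "NCod (Ident (functor_category J C) F) = F"
  "NComp (Ident (functor_category J C) F) = (\<lambda>x \<in> Obj J. Ident C (FObj F x))"
  "NDom (\<sigma> \<cdot>\<^bsub>functor_category J C\<^esub> \<tau>) = NDom \<tau>"
  "NCod (\<sigma> \<cdot>\<^bsub>functor_category J C\<^esub> \<tau>) = NCod \<sigma>"
  "NComp (\<sigma> \<cdot>\<^bsub>functor_category J C\<^esub> \<tau>) = (\<lambda>x \<in> Obj J. NComp \<sigma> x \<cdot>\<^bsub>C\<^esub> NComp \<tau> x)"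
  by (auto simp: functor_category_def)

lemma Hom_functor_category:
  "\<tau> \<in> Hom (functor_category J C) F G \<longleftrightarrow> is_nattrans J C \<tau> \<and> NDom \<tau> = F \<and> NCod \<tau> = G"
  by (simp add: Hom_iff)

lemma NComp_Hom:
  "\<tau> \<in> Hom (functor_category J C) F G \<Longrightarrow> x \<in> Obj J \<Longrightarrow> NComp \<tau> x \<in> Hom C (FObj F x) (FObj G x)"
  using is_nattransD(1) by (fastforce simp: Hom_functor_category)

lemma naturality:
  "\<tau> \<in> Hom (functor_category J C) F G \<Longrightarrow> f \<in> Hom J x y \<Longrightarrow>
    NComp \<tau> y \<cdot>\<^bsub>C\<^esub> FArr F f = FArr G f \<cdot>\<^bsub>C\<^esub> NComp \<tau> x"
  using is_nattransD(2) by (fastforce simp: Hom_functor_category)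

lemma nattrans_Hom_intro:
  assumes "is_functor J C F" "is_functor J C G" "NDom \<tau> = F" "NCod \<tau> = G"
    and "NComp \<tau> \<in> extensional (Obj J)"
    and "\<And>x. x \<in> Obj J \<Longrightarrow> NComp \<tau> x \<in> Hom C (FObj F x) (FObj G x)"
    and "\<And>f x y. f \<in> Hom J x y \<Longrightarrow> NComp \<tau> y \<cdot>\<^bsub>C\<^esub> FArr F f = FArr G f \<cdot>\<^bsub>C\<^esub> NComp \<tau> x"
  shows "\<tau> \<in> Hom (functor_category J C) F G"
  using assms by (auto simp: Hom_functor_category is_nattrans_def Hom_iff)

text \<open>Extensionality makes components \<open>undefined\<close> outside \<open>Obj J\<close>,
  and the endpoints are stored in the record, so agreement on objects already decides HOL
  equality.\<close>

lemma nattrans_eqI: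
  assumes "\<sigma> \<in> Hom (functor_category J C) F G" "\<tau> \<in> Hom (functor_category J C) F G"
    and "\<And>x. x \<in> Obj J \<Longrightarrow> NComp \<sigma> x = NComp \<tau> x"
  shows "\<sigma> = \<tau>"
proof -
  have "NComp \<sigma> = NComp \<tau>"
    using assms by (intro extensionalityI[of _ "Obj J"]) (auto simp: Hom_functor_category is_nattrans_def)
  then show ?thesis
    using assms(1,2) by (intro nattrans.equality) (auto simp: Hom_functor_category)
qed

lemma Ident_functor_Hom:
  assumes "category J" "category C" "is_functor J C F"
  shows "Ident (functor_category J C) F \<in> Hom (functor_category J C) F F"
proof (rule nattrans_Hom_intro)
  interpret J: category J by fact
  interpret C: category C by fact
  show "NComp (Ident (functor_category J C) F) x \<in> Hom C (FObj F x) (FObj F x)" if "x \<in> Obj J" for x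
    using that C.Ident_in is_functorD(1)[OF assms(3)] by simp
  show "NComp (Ident (functor_category J C) F) y \<cdot>\<^bsub>C\<^esub> FArr F f =
      FArr F f \<cdot>\<^bsub>C\<^esub> NComp (Ident (functor_category J C) F) x" if "f \<in> Hom J x y" for f x y
    using J.Hom_objects[OF that] C.Ident_left C.Ident_right is_functorD(2)[OF assms(3) that]
    by simp
qed (use assms in auto)

lemma Comp_functor_Hom:
  assumes "category J" "category C"
    and \<tau>: "\<tau> \<in> Hom (functor_category J C) F G" and \<sigma>: "\<sigma> \<in> Hom (functor_category J C) G H"
  shows "\<sigma> \<cdot>\<^bsub>functor_category J C\<^esub> \<tau> \<in> Hom (functor_category J C) F H"
proof (rule nattrans_Hom_intro)
  interpret J: category J by fact
  interpret C: category C by fact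
  show F: "is_functor J C F" and H: "is_functor J C H"
    using \<tau> \<sigma> by (auto simp: Hom_functor_category is_nattrans_def)
  have G: "is_functor J C G"
    using \<tau> by (auto simp: Hom_functor_category is_nattrans_def)
  show "NComp (\<sigma> \<cdot>\<^bsub>functor_category J C\<^esub> \<tau>) x \<in> Hom C (FObj F x) (FObj H x)" if "x \<in> Obj J" for x
    using that C.Comp_in[OF NComp_Hom[OF \<tau> that] NComp_Hom[OF \<sigma> that]] by simp
  show "NComp (\<sigma> \<cdot>\<^bsub>functor_category J C\<^esub> \<tau>) y \<cdot>\<^bsub>C\<^esub> FArr F f =
      FArr H f \<cdot>\<^bsub>C\<^esub> NComp (\<sigma> \<cdot>\<^bsub>functor_category J C\<^esub> \<tau>) x" if f: "f \<in> Hom J x y" for f x y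
  proof -
    have x: "x \<in> Obj J" and y: "y \<in> Obj J"
      using J.Hom_objects[OF f] by auto
    \<comment> \<open>The naturality square of the composite is pasted from that of \<tau>, used
      here, and that of \<sigma>, used next.\<close>
    have "(NComp \<sigma> y \<cdot>\<^bsub>C\<^esub> NComp \<tau> y) \<cdot>\<^bsub>C\<^esub> FArr F f = NComp \<sigma> y \<cdot>\<^bsub>C\<^esub> (FArr G f \<cdot>\<^bsub>C\<^esub> NComp \<tau> x)"
      using C.Comp_assoc[OF is_functorD(2)[OF F f] NComp_Hom[OF \<tau> y] NComp_Hom[OF \<sigma> y]]
        naturality[OF \<tau> f] by simp
    also have "\<dots> = FArr H f \<cdot>\<^bsub>C\<^esub> (NComp \<sigma> x \<cdot>\<^bsub>C\<^esub> NComp \<tau> x)"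
      using C.Comp_assoc[OF NComp_Hom[OF \<tau> x] is_functorD(2)[OF G f] NComp_Hom[OF \<sigma> y]]
        C.Comp_assoc[OF NComp_Hom[OF \<tau> x] NComp_Hom[OF \<sigma> x] is_functorD(2)[OF H f]]
        naturality[OF \<sigma> f] by simp
    finally show ?thesis
      using x y by simp
  qed
qed (use \<tau> \<sigma> in \<open>auto simp: Hom_functor_category\<close>)

lemma category_functor_category:
  assumes "category J" "category C"
  shows "category (functor_category J C)"
proof
  let ?F = "functor_category J C"
  fix f
  show "f \<in> Arr ?F \<Longrightarrow> Dom ?F f \<in> Obj ?F" and "f \<in> Arr ?F \<Longrightarrow> Cod ?F f \<in> Obj ?F"
    by (auto simp: is_nattrans_def)
next
  fix x
  show "x \<in> Obj (functor_category J C) \<Longrightarrow>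
      Ident (functor_category J C) x \<in> Hom (functor_category J C) x x"
    using Ident_functor_Hom[OF assms] by simp
next
  let ?F = "functor_category J C"
  fix f g x y z
  assume f: "f \<in> Hom ?F x y"
  then show gf: "g \<cdot>\<^bsub>?F\<^esub> f \<in> Hom ?F x z" if "g \<in> Hom ?F y z"
    using that Comp_functor_Hom[OF assms] by simp
next
  interpret C: category C by fact
  let ?F = "functor_category J C"
  fix f x y
  assume f: "f \<in> Hom ?F x y"
  then have xy: "is_functor J C x" "is_functor J C y"
    by (auto simp: Hom_functor_category is_nattrans_def)
  show "Ident ?F y \<cdot>\<^bsub>?F\<^esub> f = f"
    using C.Ident_left[OF NComp_Hom[OF f]]
    by (intro nattrans_eqI[OF Comp_functor_Hom[OF assms f Ident_functor_Hom[OF assms xy(2)]] f]) simp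
  show "f \<cdot>\<^bsub>?F\<^esub> Ident ?F x = f"
    using C.Ident_right[OF NComp_Hom[OF f]]
    by (intro nattrans_eqI[OF Comp_functor_Hom[OF assms Ident_functor_Hom[OF assms xy(1)] f] f]) simp
next
  interpret C: category C by fact
  let ?F = "functor_category J C"
  fix f g h w x y z
  assume f: "f \<in> Hom ?F w x" and g: "g \<in> Hom ?F x y" and h: "h \<in> Hom ?F y z"
  note comp = Comp_functor_Hom[OF assms]
  show "(h \<cdot>\<^bsub>?F\<^esub> g) \<cdot>\<^bsub>?F\<^esub> f = h \<cdot>\<^bsub>?F\<^esub> (g \<cdot>\<^bsub>?F\<^esub> f)"
    using C.Comp_assoc[OF NComp_Hom[OF f] NComp_Hom[OF g] NComp_Hom[OF h]]
    by (intro nattrans_eqI[OF comp[OF f comp[OF g h]] comp[OF comp[OF f g] h]]) simp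
qed

section \<open>Isomorphisms, and natural isomorphisms read componentwise\<close>

lemma is_iso_Hom:
  assumes "f \<in> Hom C x y"
  shows "is_iso C f \<longleftrightarrow> (\<exists>g \<in> Hom C y x. g \<cdot>\<^bsub>C\<^esub> f = Ident C x \<and> f \<cdot>\<^bsub>C\<^esub> g = Ident C y)"
  using assms by (auto simp: is_iso_def Hom_iff)

lemma isomorphicI:
  assumes "f \<in> Hom C x y" "g \<in> Hom C y x" "g \<cdot>\<^bsub>C\<^esub> f = Ident C x" "f \<cdot>\<^bsub>C\<^esub> g = Ident C y"
  shows "isomorphic C x y"
  using assms is_iso_Hom[OF assms(1)] by (auto simp: isomorphic_def)

lemma is_iso_Ident:
  assumes "category C" "x \<in> Obj C"
  shows "is_iso C (Ident C x)"
proof -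
  interpret category C by fact
  show ?thesis
    using Ident_in[OF assms(2)] Ident_left[OF Ident_in[OF assms(2)]]
    by (auto simp: is_iso_Hom[OF Ident_in[OF assms(2)]])
qed

text \<open>The inverse transformation is evaluated at \<open>x\<close>. This brings the case of an
  invertible unit into the same objectwise form as the pointwise case.\<close>

lemma natiso_components:
  assumes \<tau>: "\<tau> \<in> Hom (functor_category J C) F G" and "is_iso (functor_category J C) \<tau>"
    and x: "x \<in> Obj J"
  shows "\<exists>g \<in> Hom C (FObj G x) (FObj F x).
    g \<cdot>\<^bsub>C\<^esub> NComp \<tau> x = Ident C (FObj F x) \<and> NComp \<tau> x \<cdot>\<^bsub>C\<^esub> g = Ident C (FObj G x)"
proof -
  obtain \<sigma> where \<sigma>: "\<sigma> \<in> Hom (functor_category J C) G F"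
    and "\<sigma> \<cdot>\<^bsub>functor_category J C\<^esub> \<tau> = Ident (functor_category J C) F"
    and "\<tau> \<cdot>\<^bsub>functor_category J C\<^esub> \<sigma> = Ident (functor_category J C) G"
    using assms is_iso_Hom[OF \<tau>] by auto
  then have "NComp (\<sigma> \<cdot>\<^bsub>functor_category J C\<^esub> \<tau>) x = NComp (Ident (functor_category J C) F) x"
    "NComp (\<tau> \<cdot>\<^bsub>functor_category J C\<^esub> \<sigma>) x = NComp (Ident (functor_category J C) G) x"
    by simp_all
  then show ?thesis
    using NComp_Hom[OF \<sigma> x] x by auto
qed


section \<open>Restriction along a functor\<close>

lemma is_functor_fcomp:
  assumes "category J" "is_functor J I H" "is_functor I C G"
  shows "is_functor J C (fcomp J G H)"
proof -
  interpret J: category J by fact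
  \<comment> \<open>The composite functor is \<open>undefined\<close> outside the carriers of
    \<open>J\<close>, so its values on composites and identities can be computed only once these are
    known to be arrows of \<open>J\<close>.\<close>
  have "g \<cdot>\<^bsub>J\<^esub> f \<in> Arr J" if "f \<in> Arr J" "g \<in> Arr J" "Cod J f = Dom J g" for f g
    using J.Comp_in[of f _ _ g] that by (fastforce simp: Hom_iff)
  moreover have "Ident J x \<in> Arr J" if "x \<in> Obj J" for x
    using J.Ident_in[OF that] by (simp add: Hom_iff)
  ultimately show ?thesis
    using assms(2,3) J.Dom_in J.Cod_in
    by (auto simp: is_functor_def fcomp_def compose_def Hom_iff)
qed

lemma whisker_simps [simp]:
  "NDom (whisker J \<sigma> H) = fcomp J (NDom \<sigma>) H"
  "NCod (whisker J \<sigma> H) = fcomp J (NCod \<sigma>) H"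
  "x \<in> Obj J \<Longrightarrow> NComp (whisker J \<sigma> H) x = NComp \<sigma> (FObj H x)"
  by (auto simp: whisker_def compose_def)

lemma fcomp_simps [simp]:
  "x \<in> Obj J \<Longrightarrow> FObj (fcomp J G H) x = FObj G (FObj H x)"
  "f \<in> Arr J \<Longrightarrow> FArr (fcomp J G H) f = FArr G (FArr H f)"
  by (auto simp: fcomp_def compose_def)

lemma whisker_Hom:
  assumes "category J" and H: "is_functor J I H" and \<sigma>: "\<sigma> \<in> Hom (functor_category I C) F G"
  shows "whisker J \<sigma> H \<in> Hom (functor_category J C) (fcomp J F H) (fcomp J G H)"
proof (rule nattrans_Hom_intro)
  interpret J: category J by fact
  show "is_functor J C (fcomp J F H)" "is_functor J C (fcomp J G H)"
    using \<sigma> is_functor_fcomp[OF assms(1,2)] by (auto simp: Hom_functor_category is_nattrans_def)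
  show "NComp (whisker J \<sigma> H) x \<in> Hom C (FObj (fcomp J F H) x) (FObj (fcomp J G H) x)"
    if "x \<in> Obj J" for x
    using that NComp_Hom[OF \<sigma> is_functorD(1)[OF H]] by simp
  show "NComp (whisker J \<sigma> H) y \<cdot>\<^bsub>C\<^esub> FArr (fcomp J F H) f =
      FArr (fcomp J G H) f \<cdot>\<^bsub>C\<^esub> NComp (whisker J \<sigma> H) x" if f: "f \<in> Hom J x y" for f x y
    using naturality[OF \<sigma> is_functorD(2)[OF H f]] f J.Hom_objects[OF f] by (simp add: Hom_iff)
qed (use \<sigma> in \<open>auto simp: Hom_functor_category whisker_def compose_def\<close>)

lemma whisker_Comp:
  assumes "category J" "category I" "category C" and H: "is_functor J I H"
    and \<tau>: "\<tau> \<in> Hom (functor_category I C) E F" and \<sigma>: "\<sigma> \<in> Hom (functor_category I C) F G"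
  shows "whisker J (\<sigma> \<cdot>\<^bsub>functor_category I C\<^esub> \<tau>) H =
    whisker J \<sigma> H \<cdot>\<^bsub>functor_category J C\<^esub> whisker J \<tau> H"
proof (rule nattrans_eqI)
  show "whisker J (\<sigma> \<cdot>\<^bsub>functor_category I C\<^esub> \<tau>) H \<in>
      Hom (functor_category J C) (fcomp J E H) (fcomp J G H)"
    using whisker_Hom[OF assms(1) H] Comp_functor_Hom[OF assms(2,3) \<tau> \<sigma>] by blast
  show "whisker J \<sigma> H \<cdot>\<^bsub>functor_category J C\<^esub> whisker J \<tau> H \<in>
      Hom (functor_category J C) (fcomp J E H) (fcomp J G H)"
    using Comp_functor_Hom[OF assms(1,3)] whisker_Hom[OF assms(1) H] \<tau> \<sigma> by blast
qed (use is_functorD(1)[OF H] in simp)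

text \<open>Precomposition with \<phi> is a bijection from transformations \<open>A\<close> to
  \<open>G\<close> onto transformations \<open>K\<close> to \<open>G\<close>. Since whiskering is
  functorial, \<sigma> factorises \<alpha> through the new unit exactly when its precomposite with
  \<phi> factorises \<alpha> through \<eta>.\<close>

lemma left_Kan_transport:
  assumes "category J" "category I" "category C" and H: "is_functor J I H"
    and K: "left_Kan J I C H L K \<eta>"
    and \<phi>: "\<phi> \<in> Hom (functor_category I C) K A" and \<psi>: "\<psi> \<in> Hom (functor_category I C) A K"
    and inv: "\<psi> \<cdot>\<^bsub>functor_category I C\<^esub> \<phi> = Ident (functor_category I C) K"
      "\<phi> \<cdot>\<^bsub>functor_category I C\<^esub> \<psi> = Ident (functor_category I C) A"
  shows "left_Kan J I C H L A (whisker J \<phi> H \<cdot>\<^bsub>functor_category J C\<^esub> \<eta>)"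
proof -
  interpret IC: category "functor_category I C"
    using assms category_functor_category by blast
  interpret JC: category "functor_category J C"
    using assms category_functor_category by blast
  let ?IC = "functor_category I C" and ?JC = "functor_category J C"
  have \<eta>: "\<eta> \<in> Hom ?JC L (fcomp J K H)"
    using K by (simp add: left_Kan_def)
  have wh: "\<sigma> \<in> Hom ?IC F G \<Longrightarrow> whisker J \<sigma> H \<in> Hom ?JC (fcomp J F H) (fcomp J G H)" for \<sigma> F G
    by (rule whisker_Hom[OF assms(1) H])
  have shift: "whisker J (\<sigma> \<cdot>\<^bsub>?IC\<^esub> \<phi>) H \<cdot>\<^bsub>?JC\<^esub> \<eta> = whisker J \<sigma> H \<cdot>\<^bsub>?JC\<^esub> (whisker J \<phi> H \<cdot>\<^bsub>?JC\<^esub> \<eta>)"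
    if "\<sigma> \<in> Hom ?IC A G" for \<sigma> G
    using whisker_Comp[OF assms(1-4) \<phi> that] JC.Comp_assoc[OF \<eta> wh[OF \<phi>] wh[OF that]] by simp
  show ?thesis
    unfolding left_Kan_def
  proof (intro conjI ballI)
    show "A \<in> Obj ?IC"
      using IC.Hom_objects[OF \<phi>] by blast
    show "whisker J \<phi> H \<cdot>\<^bsub>?JC\<^esub> \<eta> \<in> Hom ?JC L (fcomp J A H)"
      using JC.Comp_in[OF \<eta> wh[OF \<phi>]] .
    fix G \<alpha> assume "G \<in> Obj ?IC" "\<alpha> \<in> Hom ?JC L (fcomp J G H)"
    then obtain \<rho> where \<rho>: "\<rho> \<in> Hom ?IC K G" "whisker J \<rho> H \<cdot>\<^bsub>?JC\<^esub> \<eta> = \<alpha>"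
      and uniq: "\<And>\<sigma>. \<sigma> \<in> Hom ?IC K G \<Longrightarrow> whisker J \<sigma> H \<cdot>\<^bsub>?JC\<^esub> \<eta> = \<alpha> \<Longrightarrow> \<sigma> = \<rho>"
      using K unfolding left_Kan_def by metis
    show "\<exists>!\<sigma>. \<sigma> \<in> Hom ?IC A G \<and> whisker J \<sigma> H \<cdot>\<^bsub>?JC\<^esub> (whisker J \<phi> H \<cdot>\<^bsub>?JC\<^esub> \<eta>) = \<alpha>"
    proof (intro ex1I conjI)
      \<comment> \<open>The witness is the preimage of the factorisation \<rho> under precomposition
        with \<phi>.\<close>
      show \<rho>\<psi>: "\<rho> \<cdot>\<^bsub>?IC\<^esub> \<psi> \<in> Hom ?IC A G"
        using IC.Comp_in[OF \<psi> \<rho>(1)] .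
      have "(\<rho> \<cdot>\<^bsub>?IC\<^esub> \<psi>) \<cdot>\<^bsub>?IC\<^esub> \<phi> = \<rho>"
        using IC.Comp_assoc[OF \<phi> \<psi> \<rho>(1)] inv IC.Ident_right[OF \<rho>(1)] by simp
      then show "whisker J (\<rho> \<cdot>\<^bsub>?IC\<^esub> \<psi>) H \<cdot>\<^bsub>?JC\<^esub> (whisker J \<phi> H \<cdot>\<^bsub>?JC\<^esub> \<eta>) = \<alpha>"
        using shift[OF \<rho>\<psi>] \<rho>(2) by simp
      fix \<sigma> assume \<sigma>: "\<sigma> \<in> Hom ?IC A G \<and>
        whisker J \<sigma> H \<cdot>\<^bsub>?JC\<^esub> (whisker J \<phi> H \<cdot>\<^bsub>?JC\<^esub> \<eta>) = \<alpha>"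
      then have "\<sigma> \<cdot>\<^bsub>?IC\<^esub> \<phi> = \<rho>"
        using uniq[OF IC.Comp_in[OF \<phi>]] shift by simp
      \<comment> \<open>Precomposing with \<psi> cancels \<phi>.\<close>
      then show "\<sigma> = \<rho> \<cdot>\<^bsub>?IC\<^esub> \<psi>"
        using \<sigma> IC.Comp_assoc[OF \<psi> \<phi>] inv IC.Ident_right by metis
    qed
  qed
qed


section \<open>Transport of structure\<close>

text \<open>Each object \<open>FObj K x\<close> is replaced by \<open>P x\<close>, and arrows are
  conjugated by isomorphisms \<phi> with inverses \<psi>. These need only be given objectwise: the
  action on arrows is the one that makes them natural. Restriction to the carriers keeps the result
  extensional.\<close>

definition transport where
  "transport I C K P \<phi> \<psi> = \<lparr>FObj = restrict P (Obj I),
     FArr = (\<lambda>f \<in> Arr I. \<phi> (Cod I f) \<cdot>\<^bsub>C\<^esub> (FArr K f \<cdot>\<^bsub>C\<^esub> \<psi> (Dom I f)))\<rparr>"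

locale iso_family =
  I: category I + C: category C for I :: "('i, 'm) cat" and C :: "('c, 'n) cat" +
  fixes K :: "('i, 'm, 'c, 'n) func" and P :: "'i \<Rightarrow> 'c" and \<phi> \<psi> :: "'i \<Rightarrow> 'n"
  assumes K: "is_functor I C K"
    and \<phi>: "x \<in> Obj I \<Longrightarrow> \<phi> x \<in> Hom C (FObj K x) (P x)"
    and \<psi>: "x \<in> Obj I \<Longrightarrow> \<psi> x \<in> Hom C (P x) (FObj K x)"
    and \<psi>\<phi>: "x \<in> Obj I \<Longrightarrow> \<psi> x \<cdot>\<^bsub>C\<^esub> \<phi> x = Ident C (FObj K x)"
    and \<phi>\<psi>: "x \<in> Obj I \<Longrightarrow> \<phi> x \<cdot>\<^bsub>C\<^esub> \<psi> x = Ident C (P x)"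
begin

abbreviation "T \<equiv> transport I C K P \<phi> \<psi>"

lemma FObj_transport: "x \<in> Obj I \<Longrightarrow> FObj T x = P x"
  by (simp add: transport_def)

lemma FArr_transport:
  "f \<in> Hom I x y \<Longrightarrow> FArr T f = \<phi> y \<cdot>\<^bsub>C\<^esub> (FArr K f \<cdot>\<^bsub>C\<^esub> \<psi> x)"
  by (simp add: transport_def Hom_iff)

lemma FArr_transport_Hom:
  assumes "f \<in> Hom I x y"
  shows "FArr T f \<in> Hom C (P x) (P y)"
  using assms I.Hom_objects[OF assms] C.Comp_in \<phi> \<psi> is_functorD(2)[OF K assms]
  by (metis FArr_transport)

text \<open>Conjugation puts \<open>\<psi> x\<close> at the right end and \<open>\<phi> y\<close> at
  the left end of \<open>FArr T f\<close>. The first square cancels \<open>\<psi> x\<close> against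
  \<open>\<phi> x\<close>, the second \<open>\<phi> y\<close> against
  \<open>\<psi> y\<close>.\<close>

lemma transport_naturality:
  assumes f: "f \<in> Hom I x y"
  shows "\<phi> y \<cdot>\<^bsub>C\<^esub> FArr K f = FArr T f \<cdot>\<^bsub>C\<^esub> \<phi> x"
    and "\<psi> y \<cdot>\<^bsub>C\<^esub> FArr T f = FArr K f \<cdot>\<^bsub>C\<^esub> \<psi> x"
proof -
  have x: "x \<in> Obj I" and y: "y \<in> Obj I"
    using I.Hom_objects[OF f] by auto
  note Kf = is_functorD(2)[OF K f]
  note Kf\<psi> = C.Comp_in[OF \<psi>[OF x] Kf]
  have "FArr T f \<cdot>\<^bsub>C\<^esub> \<phi> x = \<phi> y \<cdot>\<^bsub>C\<^esub> (FArr K f \<cdot>\<^bsub>C\<^esub> (\<psi> x \<cdot>\<^bsub>C\<^esub> \<phi> x))"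
    using C.Comp_assoc[OF \<phi>[OF x] Kf\<psi> \<phi>[OF y]] C.Comp_assoc[OF \<phi>[OF x] \<psi>[OF x] Kf]
    by (simp add: FArr_transport[OF f])
  then show "\<phi> y \<cdot>\<^bsub>C\<^esub> FArr K f = FArr T f \<cdot>\<^bsub>C\<^esub> \<phi> x"
    using \<psi>\<phi>[OF x] C.Ident_right[OF Kf] by simp
  have "\<psi> y \<cdot>\<^bsub>C\<^esub> FArr T f = (\<psi> y \<cdot>\<^bsub>C\<^esub> \<phi> y) \<cdot>\<^bsub>C\<^esub> (FArr K f \<cdot>\<^bsub>C\<^esub> \<psi> x)"
    using C.Comp_assoc[OF Kf\<psi> \<phi>[OF y] \<psi>[OF y]] by (simp add: FArr_transport[OF f])
  then show "\<psi> y \<cdot>\<^bsub>C\<^esub> FArr T f = FArr K f \<cdot>\<^bsub>C\<^esub> \<psi> x"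
    using \<psi>\<phi>[OF y] C.Ident_left[OF Kf\<psi>] by simp
qed

lemma FArr_transport_Comp:
  assumes f: "f \<in> Hom I x y" and g: "g \<in> Hom I y z"
  shows "FArr T (g \<cdot>\<^bsub>I\<^esub> f) = FArr T g \<cdot>\<^bsub>C\<^esub> FArr T f"
proof -
  have x: "x \<in> Obj I" and y: "y \<in> Obj I" and z: "z \<in> Obj I"
    using I.Hom_objects[OF f] I.Hom_objects[OF g] by auto
  note Kf = is_functorD(2)[OF K f] and Kg = is_functorD(2)[OF K g]
  note Kf\<psi> = C.Comp_in[OF \<psi>[OF x] Kf]
  have "FArr T (g \<cdot>\<^bsub>I\<^esub> f) = \<phi> z \<cdot>\<^bsub>C\<^esub> ((FArr K g \<cdot>\<^bsub>C\<^esub> FArr K f) \<cdot>\<^bsub>C\<^esub> \<psi> x)"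
    using FArr_transport[OF I.Comp_in[OF f g]] is_functorD(4)[OF K f g] by simp
  also have "\<dots> = \<phi> z \<cdot>\<^bsub>C\<^esub> (FArr K g \<cdot>\<^bsub>C\<^esub> (FArr K f \<cdot>\<^bsub>C\<^esub> \<psi> x))"
    using C.Comp_assoc[OF \<psi>[OF x] Kf Kg] by simp
  also have "\<dots> = (\<phi> z \<cdot>\<^bsub>C\<^esub> FArr K g) \<cdot>\<^bsub>C\<^esub> (FArr K f \<cdot>\<^bsub>C\<^esub> \<psi> x)"
    using C.Comp_assoc[OF Kf\<psi> Kg \<phi>[OF z]] by simp
  \<comment> \<open>Naturality of \<phi> at \<open>g\<close> does the work of inserting the identity
    \<open>\<psi> y\<close> after \<open>\<phi> y\<close> between the two factors.\<close>
  also have "\<dots> = FArr T g \<cdot>\<^bsub>C\<^esub> (\<phi> y \<cdot>\<^bsub>C\<^esub> (FArr K f \<cdot>\<^bsub>C\<^esub> \<psi> x))"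
    using transport_naturality(1)[OF g]
      C.Comp_assoc[OF Kf\<psi> \<phi>[OF y] FArr_transport_Hom[OF g]] by simp
  finally show ?thesis
    by (simp add: FArr_transport[OF f])
qed

lemma is_functor_transport: "is_functor I C T"
  unfolding is_functor_def
proof (intro conjI ballI impI)
  show "FObj T \<in> extensional (Obj I)" "FArr T \<in> extensional (Arr I)"
    by (simp_all add: transport_def)
  fix x assume x: "x \<in> Obj I"
  show "FObj T x \<in> Obj C"
    using C.Hom_objects[OF \<phi>[OF x]] x by (simp add: FObj_transport)
  show "FArr T (Ident I x) = Ident C (FObj T x)"
    using FArr_transport[OF I.Ident_in[OF x]] is_functorD(3)[OF K x] C.Ident_left[OF \<psi>[OF x]]
      \<phi>\<psi>[OF x] x by (simp add: FObj_transport)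
next
  fix f assume f: "f \<in> Arr I"
  show "FArr T f \<in> Hom C (FObj T (Dom I f)) (FObj T (Cod I f))"
    using FArr_transport_Hom[OF Arr_Hom[OF f]] I.Dom_in[OF f] I.Cod_in[OF f]
    by (simp add: FObj_transport)
  fix g assume "g \<in> Arr I" "Cod I f = Dom I g"
  then show "FArr T (g \<cdot>\<^bsub>I\<^esub> f) = FArr T g \<cdot>\<^bsub>C\<^esub> FArr T f"
    using FArr_transport_Comp[of f _ _ g] f Arr_Hom by metis
qed

abbreviation "\<Phi> \<equiv> \<lparr>NDom = K, NCod = T, NComp = restrict \<phi> (Obj I)\<rparr>"
abbreviation "\<Psi> \<equiv> \<lparr>NDom = T, NCod = K, NComp = restrict \<psi> (Obj I)\<rparr>"

lemma transport_Hom: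
  "\<Phi> \<in> Hom (functor_category I C) K T" "\<Psi> \<in> Hom (functor_category I C) T K"
  using I.Hom_objects transport_naturality
  by (auto intro!: nattrans_Hom_intro is_functor_transport K simp: FObj_transport \<phi> \<psi>)

lemma transport_inverse:
  "\<Psi> \<cdot>\<^bsub>functor_category I C\<^esub> \<Phi> = Ident (functor_category I C) K"
  "\<Phi> \<cdot>\<^bsub>functor_category I C\<^esub> \<Psi> = Ident (functor_category I C) T"
  by (auto intro!: nattrans.equality simp: \<psi>\<phi> \<phi>\<psi> FObj_transport)

end


section \<open>Extensions along the inclusion of a full subcategory\<close>

lemma full_subcategory_simps [simp]:
  "Obj (full_subcategory I S) = S"
  "Arr (full_subcategory I S) = {f \<in> Arr I. Dom I f \<in> S \<and> Cod I f \<in> S}"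
  "Dom (full_subcategory I S) = Dom I"
  "Cod (full_subcategory I S) = Cod I"
  "Ident (full_subcategory I S) = Ident I"
  "Comp (full_subcategory I S) = Comp I"
  by (simp_all add: full_subcategory_def)

lemma Hom_full_subcategory:
  "x \<in> S \<Longrightarrow> y \<in> S \<Longrightarrow> Hom (full_subcategory I S) x y = Hom I x y"
  by (auto simp: Hom_iff)

lemma inclusion_simps [simp]:
  "x \<in> Obj J \<Longrightarrow> FObj (inclusion J) x = x"
  "f \<in> Arr J \<Longrightarrow> FArr (inclusion J) f = f"
  by (simp_all add: inclusion_def)

text \<open>\<open>J\<close> is a parameter tied to \<open>S\<close> by an equation, so that the
  dual situation is an instance of the same locale with \<open>opp J\<close> in its place.\<close>

locale extension_problem =
  I: category I + C: category C for I :: "('i, 'm) cat" and C :: "('c, 'n) cat" +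
  fixes J :: "('i, 'm) cat" and S :: "'i set" and L :: "('i, 'm, 'c, 'n) func"
  assumes S: "S \<subseteq> Obj I" and J_def: "J = full_subcategory I S" and L: "is_functor J C L"
begin

sublocale J: category J
proof
  show "f \<in> Arr J \<Longrightarrow> Dom J f \<in> Obj J" and "f \<in> Arr J \<Longrightarrow> Cod J f \<in> Obj J" for f
    by (auto simp: J_def)
  show "x \<in> Obj J \<Longrightarrow> Ident J x \<in> Hom J x x" for x
    using I.Ident_in[of x] S by (auto simp: J_def Hom_iff)
  show "g \<cdot>\<^bsub>J\<^esub> f \<in> Hom J x z" if "f \<in> Hom J x y" "g \<in> Hom J y z" for f g x y z
    using I.Comp_in[of f x y g z] that by (auto simp: J_def Hom_iff)
  show "Ident J y \<cdot>\<^bsub>J\<^esub> f = f" and "f \<cdot>\<^bsub>J\<^esub> Ident J x = f" if "f \<in> Hom J x y" for f x y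
    using I.Ident_left[of f x y] I.Ident_right[of f x y] that by (auto simp: J_def Hom_iff)
  show "(h \<cdot>\<^bsub>J\<^esub> g) \<cdot>\<^bsub>J\<^esub> f = h \<cdot>\<^bsub>J\<^esub> (g \<cdot>\<^bsub>J\<^esub> f)"
    if "f \<in> Hom J w x" "g \<in> Hom J x y" "h \<in> Hom J y z" for f g h w x y z
    using I.Comp_assoc[of f w x g y h z] that by (auto simp: J_def Hom_iff)
qed

lemma inclusion_functor: "is_functor J I (inclusion J)"
proof -
  have "g \<cdot>\<^bsub>J\<^esub> f \<in> Arr J" if "f \<in> Arr J" "g \<in> Arr J" "Cod J f = Dom J g" for f g
    using J.Comp_in[of f _ _ g] that by (fastforce simp: Hom_iff)
  moreover have "Ident J x \<in> Arr J" if "x \<in> Obj J" for x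
    using J.Ident_in[OF that] by (simp add: Hom_iff)
  ultimately show ?thesis
    using S by (auto simp: is_functor_def inclusion_def J_def Hom_iff)
qed

text \<open>Fullness of the subcategory, in the form that lets an object of the comma category over
  some \<open>j\<close> in \<open>J\<close> be read as an arrow of \<open>J\<close>.\<close>

lemma Hom_J: "x \<in> Obj J \<Longrightarrow> y \<in> Obj J \<Longrightarrow> Hom J x y = Hom I x y"
  by (simp add: J_def Hom_full_subcategory)

lemma Obj_J: "x \<in> Obj J \<Longrightarrow> x \<in> Obj I"
  using S by (auto simp: J_def)

lemma Comp_J: "g \<cdot>\<^bsub>J\<^esub> f = g \<cdot>\<^bsub>I\<^esub> f" and Ident_J: "Ident J x = Ident I x"
  by (simp_all add: J_def)

section \<open>The unit of a left Kan extension on the objects of the subcategory\<close>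

lemma unit_component:
  assumes "\<eta> \<in> Hom (functor_category J C) L (fcomp J K (inclusion J))" "x \<in> Obj J"
  shows "NComp \<eta> x \<in> Hom C (FObj L x) (FObj K x)"
  using NComp_Hom[OF assms] assms(2) by simp

lemma unit_naturality:
  assumes "\<eta> \<in> Hom (functor_category J C) L (fcomp J K (inclusion J))" "f \<in> Hom J x y"
  shows "NComp \<eta> y \<cdot>\<^bsub>C\<^esub> FArr L f = FArr K f \<cdot>\<^bsub>C\<^esub> NComp \<eta> x"
  using naturality[OF assms] assms(2) by (simp add: Hom_iff)

text \<open>By fullness \<open>L\<close> is defined on every arrow into \<open>j\<close> that
  indexes the colimit, so its values form a cocone with vertex \<open>FObj L j\<close>. The
  mediating arrow is the inverse: one composite is computed at the identity of \<open>j\<close>, the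
  other by uniqueness of mediating arrows.\<close>

lemma pointwise_unit_invertible:
  assumes K: "is_functor I C K"
    and \<eta>: "\<eta> \<in> Hom (functor_category J C) L (fcomp J K (inclusion J))"
    and pw: "pointwise_left J I C (inclusion J) L K \<eta>" and j: "j \<in> Obj J"
  shows "\<exists>h \<in> Hom C (FObj K j) (FObj L j).
    h \<cdot>\<^bsub>C\<^esub> NComp \<eta> j = Ident C (FObj L j) \<and> NComp \<eta> j \<cdot>\<^bsub>C\<^esub> h = Ident C (FObj K j)"
proof -
  have jI: "j \<in> Obj I"
    using j by (rule Obj_J)
  \<comment> \<open>The colimit property at \<open>j\<close>, with the comma category indexed by
    arrows of \<open>J\<close> instead of arrows of \<open>I\<close>.\<close>
  have univ: "\<exists>!h. h \<in> Hom C (FObj K j) y \<and>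
      (\<forall>x \<in> Obj J. \<forall>f \<in> Hom J x j. h \<cdot>\<^bsub>C\<^esub> (FArr K f \<cdot>\<^bsub>C\<^esub> NComp \<eta> x) = c x f)"
    if c: "\<And>x f. f \<in> Hom J x j \<Longrightarrow> c x f \<in> Hom C (FObj L x) y"
      "\<And>u f x x'. u \<in> Hom J x x' \<Longrightarrow> f \<in> Hom J x' j \<Longrightarrow> c x' f \<cdot>\<^bsub>C\<^esub> FArr L u = c x (f \<cdot>\<^bsub>J\<^esub> u)"
      and y: "y \<in> Obj C" for y c
  proof -
    have "comma_cocone J I C (inclusion J) L j y c"
      unfolding comma_cocone_def
    proof (intro conjI ballI)
      fix x f assume "x \<in> Obj J" "f \<in> Hom I (FObj (inclusion J) x) j"
      then show "c x f \<in> Hom C (FObj L x) y"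
        using c(1)[of f x] j by (simp add: Hom_J)
    next
      fix u f assume u: "u \<in> Arr J" and "f \<in> Hom I (FObj (inclusion J) (Cod J u)) j"
      then have "f \<in> Hom J (Cod J u) j"
        using j J.Cod_in[OF u] by (simp add: Hom_J)
      then show "c (Cod J u) f \<cdot>\<^bsub>C\<^esub> FArr L u = c (Dom J u) (f \<cdot>\<^bsub>I\<^esub> FArr (inclusion J) u)"
        using c(2)[OF Arr_Hom[OF u]] u by (simp add: Comp_J)
    qed
    then have "\<exists>!h. h \<in> Hom C (FObj K j) y \<and>
        (\<forall>x \<in> Obj J. \<forall>f \<in> Hom I (FObj (inclusion J) x) j. h \<cdot>\<^bsub>C\<^esub> (FArr K f \<cdot>\<^bsub>C\<^esub> NComp \<eta> x) = c x f)"
      using pw jI y unfolding pointwise_left_def by blast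
    then show ?thesis
      using j by (simp add: Hom_J)
  qed
  have Lj: "FObj L j \<in> Obj C" and Kj: "FObj K j \<in> Obj C"
    using is_functorD(1)[OF L j] is_functorD(1)[OF K jI] by auto
  have KJ: "FArr K f \<in> Hom C (FObj K x) (FObj K y)" if "f \<in> Hom J x y" for f x y
    using that is_functorD(2)[OF K, of f x y] J.Hom_objects[OF that] by (simp add: Hom_J)
  have K\<eta>: "FArr K f \<cdot>\<^bsub>C\<^esub> NComp \<eta> x \<in> Hom C (FObj L x) (FObj K y)" if "f \<in> Hom J x y" for f x y
    using C.Comp_in[OF unit_component[OF \<eta>] KJ[OF that]] J.Hom_objects[OF that] by simp
  \<comment> \<open>The cocone sends \<open>f\<close> to \<open>FArr L f\<close>; compatibility is
    functoriality of \<open>L\<close>.\<close>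
  obtain h where h: "h \<in> Hom C (FObj K j) (FObj L j)"
    and hK: "\<And>x f. f \<in> Hom J x j \<Longrightarrow> h \<cdot>\<^bsub>C\<^esub> (FArr K f \<cdot>\<^bsub>C\<^esub> NComp \<eta> x) = FArr L f"
    using univ[of "\<lambda>x f. FArr L f" "FObj L j"] is_functorD(2,4)[OF L] Lj J.Hom_objects by metis
  have \<eta>j: "NComp \<eta> j \<in> Hom C (FObj L j) (FObj K j)"
    by (rule unit_component[OF \<eta> j])
  \<comment> \<open>The canonical cocone has component \<open>NComp \<eta> j\<close> at the
    identity, so \<open>hK\<close> evaluated there gives the first inverse law.\<close>
  have "FArr K (Ident J j) \<cdot>\<^bsub>C\<^esub> NComp \<eta> j = NComp \<eta> j"
    using is_functorD(3)[OF K jI] C.Ident_left[OF \<eta>j] by (simp add: Ident_J)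
  then have "h \<cdot>\<^bsub>C\<^esub> NComp \<eta> j = Ident C (FObj L j)"
    using hK[OF J.Ident_in[OF j]] is_functorD(3)[OF L j] by simp
  moreover have "NComp \<eta> j \<cdot>\<^bsub>C\<^esub> h = Ident C (FObj K j)"
  proof -
    \<comment> \<open>Naturality of \<eta> makes the canonical cocone compatible, so the universal
      property applies to it as a cocone over itself.\<close>
    have "(FArr K f \<cdot>\<^bsub>C\<^esub> NComp \<eta> x') \<cdot>\<^bsub>C\<^esub> FArr L u = FArr K (f \<cdot>\<^bsub>J\<^esub> u) \<cdot>\<^bsub>C\<^esub> NComp \<eta> x"
      if u: "u \<in> Hom J x x'" and f: "f \<in> Hom J x' j" for u f x x'
    proof -
      have x: "x \<in> Obj J" and x': "x' \<in> Obj J"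
        using J.Hom_objects[OF u] by auto
      have "FArr K (f \<cdot>\<^bsub>J\<^esub> u) = FArr K f \<cdot>\<^bsub>C\<^esub> FArr K u"
        using is_functorD(4)[OF K, of u x x' f j] u f x x' j by (simp add: Hom_J Comp_J)
      then show ?thesis
        using C.Comp_assoc[OF is_functorD(2)[OF L u] unit_component[OF \<eta> x'] KJ[OF f]]
          unit_naturality[OF \<eta> u] C.Comp_assoc[OF unit_component[OF \<eta> x] KJ[OF u] KJ[OF f]]
        by simp
    qed
    then have ex1: "\<exists>!k. k \<in> Hom C (FObj K j) (FObj K j) \<and> (\<forall>x \<in> Obj J. \<forall>f \<in> Hom J x j.
        k \<cdot>\<^bsub>C\<^esub> (FArr K f \<cdot>\<^bsub>C\<^esub> NComp \<eta> x) = FArr K f \<cdot>\<^bsub>C\<^esub> NComp \<eta> x)"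
      (is "\<exists>!k. ?P k")
      using K\<eta> Kj by (intro univ) auto
    \<comment> \<open>Both this composite and the identity mediate the canonical cocone to itself:
      \<open>h\<close> sends the component at \<open>f\<close> to \<open>FArr L f\<close>, and
      naturality of \<eta> turns this back into the component at \<open>f\<close>.\<close>
    have \<eta>h: "?P (NComp \<eta> j \<cdot>\<^bsub>C\<^esub> h)"
      using C.Comp_assoc[OF K\<eta> h \<eta>j] hK unit_naturality[OF \<eta>] C.Comp_in[OF h \<eta>j] by simp
    have id: "?P (Ident C (FObj K j))"
      using C.Ident_in[OF Kj] C.Ident_left[OF K\<eta>] by simp
    show ?thesis
      using the1_equality[OF ex1 \<eta>h] the1_equality[OF ex1 id] by (rule subst)
  qed
  ultimately show ?thesis
    using h by blast
qed

text \<open>The two alternatives in \<open>is_Lan\<close> meet here; afterwards only objectwise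
  inverses of the unit are used.\<close>

lemma is_Lan_unit_invertible:
  assumes "is_Lan J I C L K \<eta>" "j \<in> Obj J"
  shows "\<exists>h \<in> Hom C (FObj K j) (FObj L j).
    h \<cdot>\<^bsub>C\<^esub> NComp \<eta> j = Ident C (FObj L j) \<and> NComp \<eta> j \<cdot>\<^bsub>C\<^esub> h = Ident C (FObj K j)"
proof -
  have K: "is_functor I C K" and \<eta>: "\<eta> \<in> Hom (functor_category J C) L (fcomp J K (inclusion J))"
    using assms(1) by (auto simp: is_Lan_def left_Kan_def)
  show ?thesis
    using assms pointwise_unit_invertible[OF K \<eta>] natiso_components[OF \<eta> _ assms(2)]
    by (auto simp: is_Lan_def)
qed

text \<open>With identity unit, the factorisation equation for the identity transformation of
  \<open>L\<close> becomes the condition that defines arrows of \<open>Auto\<close>. The universal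
  property at an accepting \<open>B\<close> is then unique existence of an arrow.\<close>

lemma initial_object_Auto:
  assumes A: "left_Kan J I C (inclusion J) L A (Ident (functor_category J C) L)"
  shows "initial_object (Auto J I C L) A"
proof -
  interpret JC: category "functor_category J C"
    using category_functor_category[OF J.category_axioms C.category_axioms] .
  let ?id = "Ident (functor_category J C) L"
  \<comment> \<open>Transformations carry their endpoints: an identity on \<open>L\<close> can be a
    unit into the restriction of \<open>A\<close> only if that restriction equals
    \<open>L\<close>.\<close>
  have accA: "accepts J A L" and A_functor: "is_functor I C A"
    using A by (auto simp: left_Kan_def Hom_functor_category accepts_def)
  \<comment> \<open>Both functors restrict strictly to \<open>L\<close>, so the whiskered
    transformation is an endomorphism of \<open>L\<close> and composing it with the identity changes
    nothing.\<close>
  have Hom_Auto: "\<sigma> \<in> Hom (Auto J I C L) A B \<longleftrightarrow>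
      \<sigma> \<in> Hom (functor_category I C) A B \<and>
        whisker J \<sigma> (inclusion J) \<cdot>\<^bsub>functor_category J C\<^esub> ?id = ?id"
    if accB: "accepts J B L" for \<sigma> B
  proof (cases "\<sigma> \<in> Hom (functor_category I C) A B")
    case True
    then have "whisker J \<sigma> (inclusion J) \<in> Hom (functor_category J C) L L"
      using whisker_Hom[OF J.category_axioms inclusion_functor True] accA accB
      by (simp add: accepts_def)
    then have "whisker J \<sigma> (inclusion J) \<cdot>\<^bsub>functor_category J C\<^esub> ?id = whisker J \<sigma> (inclusion J)"
      by (rule JC.Ident_right)
    then show ?thesis
      using True accA accB by (simp add: Auto_def Hom_iff)
  qed (auto simp: Auto_def Hom_iff)
  have "\<exists>!\<sigma>. \<sigma> \<in> Hom (Auto J I C L) A B" if "B \<in> Obj (Auto J I C L)" for B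
  proof -
    have B: "is_functor I C B" and accB: "accepts J B L"
      using that by (auto simp: Auto_def)
    then have "?id \<in> Hom (functor_category J C) L (fcomp J B (inclusion J))"
      using Ident_functor_Hom[OF J.category_axioms C.category_axioms L] by (simp add: accepts_def)
    then show ?thesis
      using A B unfolding left_Kan_def Hom_Auto[OF accB] by simp
  qed
  then show ?thesis
    using accA A_functor by (auto simp: initial_object_def Auto_def)
qed

lemma Lan_initial:
  assumes Lan: "is_Lan J I C L K \<eta>"
  shows "\<exists>A. initial_object (Auto J I C L) A \<and>
             is_Lan J I C L A (Ident (functor_category J C) L) \<and>
             isomorphic (functor_category I C) A K"
proof -
  have Kan: "left_Kan J I C (inclusion J) L K \<eta>" and K: "is_functor I C K"
    and \<eta>: "\<eta> \<in> Hom (functor_category J C) L (fcomp J K (inclusion J))"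
    using Lan by (auto simp: is_Lan_def left_Kan_def)
  obtain h where h: "\<And>j. j \<in> Obj J \<Longrightarrow> h j \<in> Hom C (FObj K j) (FObj L j)"
    "\<And>j. j \<in> Obj J \<Longrightarrow> h j \<cdot>\<^bsub>C\<^esub> NComp \<eta> j = Ident C (FObj L j)"
    "\<And>j. j \<in> Obj J \<Longrightarrow> NComp \<eta> j \<cdot>\<^bsub>C\<^esub> h j = Ident C (FObj K j)"
    using is_Lan_unit_invertible[OF Lan] by metis
  \<comment> \<open>On \<open>J\<close> the objects are those of \<open>L\<close>, with the unit and
    its inverse as comparison arrows; elsewhere \<open>K\<close> is kept, with identities.\<close>
  define P where "P x = (if x \<in> Obj J then FObj L x else FObj K x)" for x
  define \<phi> where "\<phi> x = (if x \<in> Obj J then h x else Ident C (FObj K x))" for x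
  define \<psi> where "\<psi> x = (if x \<in> Obj J then NComp \<eta> x else Ident C (FObj K x))" for x
  have Kid: "Ident C (FObj K x) \<in> Hom C (FObj K x) (FObj K x)" if "x \<in> Obj I" for x
    using C.Ident_in is_functorD(1)[OF K that] by simp
  interpret iso_family I C K P \<phi> \<psi>
    using K h Kid C.Ident_left[OF Kid] unit_component[OF \<eta>]
    by unfold_locales (auto simp: P_def \<phi>_def \<psi>_def)
  \<comment> \<open>Naturality moves the unit to the left of \<open>FArr L f\<close>, where its
    inverse \<open>h\<close> cancels it.\<close>
  have Arr_T: "FArr T f = FArr L f" if f: "f \<in> Arr J" for f
  proof -
    note fJ = Arr_Hom[OF f]
    have x: "Dom J f \<in> Obj J" and y: "Cod J f \<in> Obj J"
      using J.Hom_objects[OF fJ] by auto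
    note Lf = is_functorD(2)[OF L fJ]
    have "FArr T f = h (Cod J f) \<cdot>\<^bsub>C\<^esub> (FArr K f \<cdot>\<^bsub>C\<^esub> NComp \<eta> (Dom J f))"
      using FArr_transport[of f "Dom J f" "Cod J f"] fJ x y by (simp add: Hom_J \<phi>_def \<psi>_def)
    also have "\<dots> = (h (Cod J f) \<cdot>\<^bsub>C\<^esub> NComp \<eta> (Cod J f)) \<cdot>\<^bsub>C\<^esub> FArr L f"
      using unit_naturality[OF \<eta> fJ] C.Comp_assoc[OF Lf unit_component[OF \<eta> y] h(1)[OF y]] by simp
    finally show ?thesis
      using h(2)[OF y] C.Ident_left[OF Lf] by simp
  qed
  have TL: "fcomp J T (inclusion J) = L"
  proof (rule func.equality)
    show "FObj (fcomp J T (inclusion J)) = FObj L"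
      using L by (intro extensionalityI[of _ "Obj J"])
        (auto simp: is_functor_def FObj_transport Obj_J P_def fcomp_def compose_def)
    show "FArr (fcomp J T (inclusion J)) = FArr L"
      using L by (intro extensionalityI[of _ "Arr J"])
        (auto simp: is_functor_def Arr_T fcomp_def compose_def)
  qed simp
  have "whisker J \<Phi> (inclusion J) \<in> Hom (functor_category J C) (fcomp J K (inclusion J)) L"
    using whisker_Hom[OF J.category_axioms inclusion_functor transport_Hom(1)] TL by simp
  \<comment> \<open>The transported unit has components \<open>h j\<close> after
    \<open>NComp \<eta> j\<close>, which are identities.\<close>
  then have "whisker J \<Phi> (inclusion J) \<cdot>\<^bsub>functor_category J C\<^esub> \<eta> = Ident (functor_category J C) L"
    using h(2) Obj_J
    by (intro nattrans_eqI[OF Comp_functor_Hom[OF J.category_axioms C.category_axioms \<eta>]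
          Ident_functor_Hom[OF J.category_axioms C.category_axioms L]]) (auto simp: \<phi>_def)
  then have T: "left_Kan J I C (inclusion J) L T (Ident (functor_category J C) L)"
    using left_Kan_transport[OF J.category_axioms I.category_axioms C.category_axioms
        inclusion_functor Kan transport_Hom transport_inverse] by simp
  \<comment> \<open>An identity unit is invertible, so the second alternative in
    \<open>is_Lan\<close> holds for the new functor whichever one held for \<open>K\<close>.\<close>
  have "is_iso (functor_category J C) (Ident (functor_category J C) L)"
    using is_iso_Ident[OF category_functor_category[OF J.category_axioms C.category_axioms]] L by simp
  then have "is_Lan J I C L T (Ident (functor_category J C) L)"
    using T by (simp add: is_Lan_def)
  moreover have "isomorphic (functor_category I C) T K"
    using isomorphicI[OF transport_Hom(2,1) transport_inverse(2,1)] .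
  ultimately show ?thesis
    using initial_object_Auto[OF T] by blast
qed

end


section \<open>Opposite categories\<close>

definition opp :: "('o, 'a) cat \<Rightarrow> ('o, 'a) cat" where
  "opp C = \<lparr>Obj = Obj C, Arr = Arr C, Dom = Cod C, Cod = Dom C, Ident = Ident C,
            Comp = (\<lambda>g f. f \<cdot>\<^bsub>C\<^esub> g)\<rparr>"

text \<open>A functor between opposite categories is literally the same record, but a transformation
  stores its endpoints, which must be exchanged.\<close>

definition opp_nattrans :: "('o, 'a, 'p, 'b) nattrans \<Rightarrow> ('o, 'a, 'p, 'b) nattrans" where
  "opp_nattrans \<tau> = \<lparr>NDom = NCod \<tau>, NCod = NDom \<tau>, NComp = NComp \<tau>\<rparr>"

lemma opp_simps [simp]:
  "Obj (opp C) = Obj C" "Arr (opp C) = Arr C" "Dom (opp C) = Cod C" "Cod (opp C) = Dom C"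
  "Ident (opp C) = Ident C" "g \<cdot>\<^bsub>opp C\<^esub> f = f \<cdot>\<^bsub>C\<^esub> g"
  "Hom (opp C) x y = Hom C y x"
  by (auto simp: opp_def Hom_def)

lemma opp_nattrans_simps [simp]:
  "NDom (opp_nattrans \<tau>) = NCod \<tau>" "NCod (opp_nattrans \<tau>) = NDom \<tau>"
  "NComp (opp_nattrans \<tau>) = NComp \<tau>" "opp_nattrans (opp_nattrans \<tau>) = \<tau>"
  by (simp_all add: opp_nattrans_def)

lemma opp_nattrans_eq_iff [simp]: "opp_nattrans \<sigma> = opp_nattrans \<tau> \<longleftrightarrow> \<sigma> = \<tau>"
  by (metis opp_nattrans_simps(4))

text \<open>\<open>opp_nattrans\<close> is an involution, hence onto. Reindexing a bound
  transformation along it exposes \<open>opp_nattrans\<close> to the rewrite rules for dual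
  notions.\<close>

lemma all_opp_nattrans: "(\<forall>\<tau>. Q \<tau>) \<longleftrightarrow> (\<forall>\<tau>. Q (opp_nattrans \<tau>))"
proof
  assume *: "\<forall>\<tau>. Q (opp_nattrans \<tau>)"
  show "\<forall>\<tau>. Q \<tau>"
  proof
    fix \<tau>
    show "Q \<tau>"
      using *[THEN spec, of "opp_nattrans \<tau>"] by simp
  qed
qed simp

lemma ex_opp_nattrans: "(\<exists>\<tau>. Q \<tau>) \<longleftrightarrow> (\<exists>\<tau>. Q (opp_nattrans \<tau>))"
  using all_opp_nattrans[of "\<lambda>\<tau>. \<not> Q \<tau>"] by blast

lemma ex1_opp_nattrans: "(\<exists>!\<tau>. Q \<tau>) \<longleftrightarrow> (\<exists>!\<tau>. Q (opp_nattrans \<tau>))"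
proof -
  have "(\<forall>\<sigma>. Q \<sigma> \<longrightarrow> \<sigma> = opp_nattrans \<tau>) \<longleftrightarrow> (\<forall>\<sigma>. Q (opp_nattrans \<sigma>) \<longrightarrow> \<sigma> = \<tau>)" for \<tau>
    by (subst all_opp_nattrans) simp
  then show ?thesis
    unfolding Ex1_def by (subst ex_opp_nattrans) simp
qed

section \<open>Functors and natural transformations between opposite categories\<close>

lemma category_opp:
  assumes "category C"
  shows "category (opp C)"
proof -
  interpret category C by fact
  show ?thesis
  proof
    fix f g h w x y z
    assume f: "f \<in> Hom (opp C) w x" and g: "g \<in> Hom (opp C) x y"
    show "g \<cdot>\<^bsub>opp C\<^esub> f \<in> Hom (opp C) w y"
      using f g Comp_in[of g y x f w] by simp
    show "(h \<cdot>\<^bsub>opp C\<^esub> g) \<cdot>\<^bsub>opp C\<^esub> f = h \<cdot>\<^bsub>opp C\<^esub> (g \<cdot>\<^bsub>opp C\<^esub> f)" if "h \<in> Hom (opp C) y z"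
      using f g that Comp_assoc[of h z y g x f w] by simp
  qed (auto simp: Dom_in Cod_in Ident_in Ident_left Ident_right)
qed

lemma full_subcategory_opp: "full_subcategory (opp I) S = opp (full_subcategory I S)"
  by (auto simp: full_subcategory_def opp_def)

lemma inclusion_opp [simp]: "inclusion (opp J) = inclusion J"
  by (simp add: inclusion_def)

lemma fcomp_opp [simp]: "fcomp (opp J) = fcomp J"
  by (simp add: fcomp_def fun_eq_iff)

lemma is_functor_opp [simp]: "is_functor (opp J) (opp C) F \<longleftrightarrow> is_functor J C F"
  by (auto simp: is_functor_def)

lemma is_nattrans_opp [simp]:
  "is_nattrans (opp J) (opp C) (opp_nattrans \<tau>) \<longleftrightarrow> is_nattrans J C \<tau>"
  by (auto simp: is_nattrans_def)

lemma Hom_functor_category_opp [simp]: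
  "opp_nattrans \<tau> \<in> Hom (functor_category (opp J) (opp C)) F G \<longleftrightarrow>
    \<tau> \<in> Hom (functor_category J C) G F"
  by (auto simp: Hom_functor_category)

lemma Comp_functor_category_opp [simp]:
  "opp_nattrans \<sigma> \<cdot>\<^bsub>functor_category (opp J) (opp C)\<^esub> opp_nattrans \<tau> =
    opp_nattrans (\<tau> \<cdot>\<^bsub>functor_category J C\<^esub> \<sigma>)"
  by (simp add: functor_category_def opp_nattrans_def)

lemma Ident_functor_category_opp [simp]:
  "Ident (functor_category (opp J) (opp C)) F = opp_nattrans (Ident (functor_category J C) F)"
  by (simp add: functor_category_def opp_nattrans_def)

lemma whisker_opp [simp]: "whisker (opp J) (opp_nattrans \<sigma>) F = opp_nattrans (whisker J \<sigma> F)"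
  by (simp add: whisker_def opp_nattrans_def)

lemma is_iso_opp [simp]:
  "is_iso (functor_category (opp J) (opp C)) (opp_nattrans \<tau>) \<longleftrightarrow> is_iso (functor_category J C) \<tau>"
  unfolding is_iso_def Bex_def by (subst ex_opp_nattrans) auto

lemma isomorphic_opp [simp]:
  "isomorphic (functor_category (opp J) (opp C)) F G \<longleftrightarrow> isomorphic (functor_category J C) G F"
  unfolding isomorphic_def Bex_def by (subst ex_opp_nattrans) simp

lemma isomorphic_sym: "isomorphic C x y \<Longrightarrow> isomorphic C y x"
  using is_iso_Hom isomorphicI unfolding isomorphic_def by metis

section \<open>Duality for Kan extensions and for automata\<close>

lemma left_Kan_opp [simp]:
  "left_Kan (opp J) (opp I) (opp C) H L K (opp_nattrans \<epsilon>) \<longleftrightarrow> right_Kan J I C H L K \<epsilon>"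
  \<comment> \<open>Reindexing both \<alpha> and \<sigma> along \<open>opp_nattrans\<close> turns
    each condition into its dual.\<close>
  unfolding left_Kan_def right_Kan_def Ball_def
  by (subst all_opp_nattrans, subst ex1_opp_nattrans) simp

text \<open>Reversing arrows exchanges the two comma categories, and cocones with cones. The
  bracketing of the composites also matches, so unfolding is enough.\<close>

lemma pointwise_left_opp [simp]:
  "pointwise_left (opp J) (opp I) (opp C) H L K (opp_nattrans \<epsilon>) \<longleftrightarrow> pointwise_right J I C H L K \<epsilon>"
  by (simp add: pointwise_left_def pointwise_right_def comma_cocone_def comma_cone_def)

lemma is_Lan_opp:
  "is_Lan (opp J) (opp I) (opp C) L K (opp_nattrans \<epsilon>) \<longleftrightarrow> is_Ran J I C L K \<epsilon>"
  by (simp add: is_Lan_def is_Ran_def)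

text \<open>\<open>opp_nattrans\<close> commutes with whiskering and preserves identities, so it
  matches the arrows of the two automata categories, reversing their direction.\<close>

lemma initial_object_Auto_opp:
  "initial_object (Auto (opp J) (opp I) (opp C) L) A \<longleftrightarrow> final_object (Auto J I C L) A"
proof -
  have "opp_nattrans \<sigma> \<in> Hom (Auto (opp J) (opp I) (opp C) L) F G \<longleftrightarrow> \<sigma> \<in> Hom (Auto J I C L) G F"
    for \<sigma> F G
    by (auto simp: Auto_def Hom_iff accepts_def)
  then show ?thesis
    unfolding initial_object_def final_object_def
    by (subst ex1_opp_nattrans) (simp add: Auto_def accepts_def)
qed

lemma (in extension_problem) extension_problem_opp: "extension_problem (opp I) (opp C) (opp J) S L"
  using S L category_opp[OF I.category_axioms] category_opp[OF C.category_axioms]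
  by (simp add: extension_problem_def extension_problem_axioms_def J_def full_subcategory_opp)

lemma (in extension_problem) Ran_final:
  assumes "is_Ran J I C L K \<epsilon>"
  shows "\<exists>A. final_object (Auto J I C L) A \<and>
             is_Ran J I C L A (Ident (functor_category J C) L) \<and>
             isomorphic (functor_category I C) A K"
proof -
  have "is_Lan (opp J) (opp I) (opp C) L K (opp_nattrans \<epsilon>)"
    using assms by (simp only: is_Lan_opp)
  from extension_problem.Lan_initial[OF extension_problem_opp this]
  \<comment> \<open>Dualising back reverses the isomorphism between \<open>A\<close> and
    \<open>K\<close> as well, which symmetry then repairs.\<close>
  obtain A where "final_object (Auto J I C L) A"
    and "is_Ran J I C L A (Ident (functor_category J C) L)" and "isomorphic (functor_category I C) K A"
    by (auto simp: is_Lan_opp initial_object_Auto_opp)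
  then show ?thesis
    using isomorphic_sym[of _ K A] by blast
qed

theorem lemma2p9:
  fixes I J :: "('i, 'm) cat" and C :: "('c, 'n) cat" and L :: "('i, 'm, 'c, 'n) func"
    and S :: "'i set"
  assumes "category I"
    and "S \<subseteq> Obj I" and "J = full_subcategory I S"
    and "category C"
    and "is_functor J C L"
  shows "(\<forall>K \<eta>. is_Lan J I C L K \<eta> \<longrightarrow>
            (\<exists>A. initial_object (Auto J I C L) A \<and>
                 is_Lan J I C L A (Ident (functor_category J C) L) \<and>
                 isomorphic (functor_category I C) A K)) \<and>
         (\<forall>K \<epsilon>. is_Ran J I C L K \<epsilon> \<longrightarrow>
            (\<exists>A. final_object (Auto J I C L) A \<and>
                 is_Ran J I C L A (Ident (functor_category J C) L) \<and>
                 isomorphic (functor_category I C) A K))"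
proof -
  interpret extension_problem I C J S L
    using assms by (simp add: extension_problem_def extension_problem_axioms_def)
  show ?thesis
    using Lan_initial Ran_final by blast
qed

end
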